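(* Let $m\ge n\ge 0$ be integers and let $\lambda$ be a partition inside an $n\times m$ board ($n$ rows, $m$ columns). For a column index $j$ let $\lambda^{[j]}$ denote $\lambda$ with column $j$ removed; for a row index $i$ let $\lambda_{[i]}$ denote $\lambda$ with row $i$ removed; and for a cell $(i,j)\in\lambda$ let $\lambda/(i,j)$ denote $\lambda$ with row $i$ and column $j$ removed. Consider the following three families of $q$-hit identities, indexed by $k$: $$\text{(H1)}\quad \sum_{i=1}^m q^{m+n-i-\lambda_i'}H_k^{m-1,n}(\lambda^{[i]})=[m-n]\,H_k^{m,n}(\lambda)\,q^{n-k},\qquad 0\le k\le n \quad(\text{for } m>n),$$ $$\text{(H2)}\quad [m-n+1]\sum_{i=m+1}^{m+n}q^{m+n-i-\lambda_i'}H_k^{m,n-1}(\lambda_{[m+n+1-i]})=H_k^{m,n}(\lambda)\,q^k[n-k]+H_{k+1}^{m,n}(\lambda)\,[k+1],\qquad 0\le k\le n-1\quad (\text{for } n\ge1),$$ $$\text{(H3)}\quad q^k\sum_{(i,j)\in\lambda}q^{i+(m-j-\lambda_j')}H_k^{m-1,n-1}(\lambda/(i,j))=[k+1]H_{k+1}^{m,n}(\lambda),\qquad 0\le k\le n-1\quad (\text{for } n\ge1).$$ These are equivalent, in that order (each family of identities in $k$ to the corresponding family), to the following $q$-rook identities: $$\text{(R1)}\quad \sum_{j=1}^m q^{m-j}R_k(\lambda^{[j]})=R_k(\lambda)[m-k]-R_{k+1}(\lambda)\,(q^m-q^{m-k-1}),\qquad 0\le k\le n,$$ $$\text{(R2)}\quad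 \sum_{i=1}^n q^{i-1+\lambda_i}R_k(\lambda_{[i]})=([n]-[k])R_k(\lambda),\qquad 0\le k\le n,$$ $$\text{(R3)}\quad \sum_{(i,j)\in\lambda}q^{i-j+\lambda_i}R_k(\lambda/(i,j))=q[k+1]R_{k+1}(\lambda),\qquad 0\le k\le n-1 .$$ That is, (H1) is equivalent to (R1), (H2) to (R2), and (H3) to (R3).
   Context: $q$-notation: $[x]=(1-q^x)/(1-q)$, $[a]_k=[a][a-1]\cdots[a-k+1]$, $[a]!=[a]_a$, and $(x;q)_k=\prod_{i=0}^{k-1}(1-xq^i)$; $q$ is an indeterminate. Boards and partitions: cell $(i,j)$ is in row $i$ from the top and column $j$ from the left. A partition $\lambda=(\lambda_1\ge\cdots\ge\lambda_n\ge 0)$ with $\lambda_1\le m$ is identified with the set of cells $(i,j)$ with $j\le\lambda_i$; $|\lambda|$ is its number of cells and $\lambda'_j$ is the number of cells in column $j$ (so $\lambda'_j=0$ for $j>\lambda_1$, in particular for $j>m$). Removing an empty row or column leaves the nonzero parts of $\lambda$ unchanged. $q$-rook numbers: $R_k(\lambda)=\sum_p q^{\mathrm{inv}(p)}$ over all placements $p$ of $k$ non-attacking rooks on cells of $\lambda$ (no two in the same row or column), where $\mathrm{inv}(p)$ is the number of cells of $\lambda$ left after each rook cancels its own cell, the cells North of it in its column, and the cells West of it in its row. $R_k(\lambda)=0$ if no such placement exists. $q$-hit numbers: for $\lambda$ inside an $n\times m$ board with $n\le m$, the $H_i^{m,n}(\lambda)$ are defined by $$\sum_{i=0}^n H_i^{m,n}(\lambda)x^i=\frac{q^{-|\lambda|}}{[m-n]!}\sum_{i=0}^n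 R_i(\lambda)\,[m-i]!\,(-1)^i q^{mi-\binom i2}(x;q)_i .$$ *)

theory Defs
  imports
    "HOL-Computational_Algebra.Fraction_Field"
    "HOL-Computational_Algebra.Polynomial"
begin

type_synonym ratfun = "rat poly fract"

definition q :: ratfun
  where "q = Fraction_Field.Fract [:0, 1:] 1"

definition qnum :: "int \<Rightarrow> ratfun"
  where "qnum x = (1 - q powi x) / (1 - q)"

definition qfalling :: "nat \<Rightarrow> nat \<Rightarrow> ratfun"
  where "qfalling a k = (\<Prod>i<k. qnum (int a - int i))"

definition qfactorial :: "nat \<Rightarrow> ratfun"
  where "qfactorial a = qfalling a a"

text \<open>The polynomial \<open>(x; q)\<^sub>k\<close> in \<open>x\<close>, with coefficients in the field of rational functions in \<open>q\<close>.\<close>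

definition qpoch_poly :: "nat \<Rightarrow> ratfun poly"
  where "qpoch_poly k = (\<Prod>i<k. [:1, - (q ^ i):])"

text \<open>
  A partition inside an \<open>n \<times> m\<close> board is the list of its \<open>n\<close> parts, zeros included.
  Rows, columns and parts are numbered from 1.
\<close>

definition partition_in :: "nat \<Rightarrow> nat \<Rightarrow> nat list \<Rightarrow> bool"
  where "partition_in n m lam \<longleftrightarrow>
    length lam = n \<and> sorted_wrt (\<ge>) lam \<and> (\<forall>p\<in>set lam. p \<le> m)"

definition part :: "nat list \<Rightarrow> nat \<Rightarrow> nat"
  where "part lam i = (if 1 \<le> i \<and> i \<le> length lam then lam ! (i - 1) else 0)"

definition cells :: "nat list \<Rightarrow> (nat \<times> nat) set"
  where "cells lam = {(i, j). 1 \<le> i \<and> i \<le> length lam \<and> 1 \<le> j \<and> j \<le> part lam i}"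

definition conj_part :: "nat list \<Rightarrow> nat \<Rightarrow> nat"
  where "conj_part lam j = card {i. (i, j) \<in> cells lam}"

definition remove_row :: "nat \<Rightarrow> nat list \<Rightarrow> nat list"
  where "remove_row i lam = take (i - 1) lam @ drop i lam"

definition remove_col :: "nat \<Rightarrow> nat list \<Rightarrow> nat list"
  where "remove_col j lam = map (\<lambda>p. if j \<le> p then p - 1 else p) lam"

definition remove_cell :: "nat \<Rightarrow> nat \<Rightarrow> nat list \<Rightarrow> nat list"
  where "remove_cell i j lam = remove_col j (remove_row i lam)"

definition rook_placements :: "nat \<Rightarrow> nat list \<Rightarrow> (nat \<times> nat) set set"
  where "rook_placements k lam =
    {p. p \<subseteq> cells lam \<and> card p = k \<and> inj_on fst p \<and> inj_on snd p}"

text \<open>North is towards smaller row indices, West towards smaller column indices;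
  the weak inequalities make a rook cancel its own cell too.\<close>

definition cancelled :: "nat \<times> nat \<Rightarrow> (nat \<times> nat) set"
  where "cancelled c = {(i, j). (j = snd c \<and> i \<le> fst c) \<or> (i = fst c \<and> j \<le> snd c)}"

definition rook_inv :: "nat list \<Rightarrow> (nat \<times> nat) set \<Rightarrow> nat"
  where "rook_inv lam p = card (cells lam - (\<Union>c\<in>p. cancelled c))"

definition qrook :: "nat \<Rightarrow> nat list \<Rightarrow> ratfun"
  where "qrook k lam = (\<Sum>p\<in>rook_placements k lam. q ^ rook_inv lam p)"

text \<open>
  The generating polynomial in \<open>x\<close> of the \<open>q\<close>-hit numbers, meaningful for \<open>n \<le> m\<close>;
  the \<open>q\<close>-hit numbers are its coefficients.
\<close>

definition qhit_poly :: "nat \<Rightarrow> nat \<Rightarrow> nat list \<Rightarrow> ratfun poly"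
  where "qhit_poly m n lam =
    smult (q powi (- int (card (cells lam))) / qfactorial (m - n))
      (\<Sum>i\<le>n. smult (qrook i lam * qfactorial (m - i) * (-1) ^ i
                      * q powi (int (m * i) - int (i choose 2)))
                (qpoch_poly i))"

definition qhit :: "nat \<Rightarrow> nat \<Rightarrow> nat \<Rightarrow> nat list \<Rightarrow> ratfun"
  where "qhit k m n lam = coeff (qhit_poly m n lam) k"

end

theory Submission imports Defs begin

text \<open>
  The rook numbers of \<open>lam\<close> are, up to invertible weights, the coordinates of the hit polynomial in
  the basis \<open>(x; q)\<^sub>i\<close>, so every linear identity between hit numbers translates into one between
  rook numbers by comparing coordinates. In each of the three families the deleted rows and
  columns change \<open>q\<^bsup>-|lam|\<^esup>\<close> by exactly the power of \<open>q\<close> that is absorbed by the exponent in front of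
  the hit number (\<open>card_cells_remove_col\<close>, \<open>card_cells_remove_row\<close>, \<open>card_cells_remove_cell\<close>), so the
  left-hand side becomes a combination of the \<open>(x; q)\<^sub>i\<close> whose coordinates are the left-hand sides
  of the rook identities times common weights.

  The factors depending on \<open>k\<close> act on generating polynomials: \<open>q\<^bsup>-k\<^esup>\<close> and \<open>q\<^bsup>k\<^esup>\<close> are the substitutions
  \<open>x \<mapsto> x / q\<close> and \<open>x \<mapsto> q x\<close>, the factor \<open>[k + 1]\<close> together with the shift \<open>k \<mapsto> k + 1\<close> is the
  \<open>q\<close>-derivative, and \<open>q\<^bsup>k\<^esup> [n - k] = [n] - [k]\<close>. Their effect on the basis follows from two relations
  for the coefficients of \<open>(x; q)\<^sub>i\<close>: the ratio of consecutive coefficients of one polynomial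
  (\<open>coeff_qpoch_ratio\<close>), and the ratio of the coefficients at the same place of two consecutive
  polynomials (\<open>coeff_qpoch_lower\<close>). Triangularity of the basis (\<open>qpoch_combination_eq_iff\<close>) then makes
  the comparison of coordinates an equivalence.
\<close>

section \<open>The indeterminate and the \<open>q\<close>-numbers\<close>

lemma q_power_eq_Fract: "q ^ k = Fraction_Field.Fract (monom 1 k) 1"
proof (induction k)
  case 0
  show ?case by (simp add: One_fract_def monom_0 one_pCons)
next
  case (Suc k)
  then show ?case by (simp add: q_def monom_Suc)
qed

lemma q_nonzero [simp]: "q \<noteq> 0"
  by (simp add: q_def Zero_fract_def eq_fract)

lemma q_power_neq_1:
  assumes "k > 0"
  shows "q ^ k \<noteq> 1"
proof
  assume "q ^ k = 1"
  then have "monom 1 k = (1 :: rat poly)"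
    by (simp add: q_power_eq_Fract One_fract_def eq_fract)
  then have "degree (monom (1 :: rat) k) = 0" by simp
  then show False using assms by (simp add: degree_monom_eq)
qed

lemma q_neq_1 [simp]: "q \<noteq> 1" "1 \<noteq> q"
  using q_power_neq_1 [of 1] by auto

lemma qnum_of_nat: "qnum (int a) = (1 - q ^ a) / (1 - q)"
  by (simp add: qnum_def)

lemma qnum_0 [simp]: "qnum 0 = 0"
  by (simp add: qnum_def)

lemma qnum_nonzero: "a > 0 \<Longrightarrow> qnum (int a) \<noteq> 0"
  using q_power_neq_1 [of a] by (auto simp: qnum_of_nat)

lemma one_minus_q_mult_qnum: "(1 - q) * qnum (int a) = 1 - q ^ a"
  by (simp add: qnum_of_nat)

lemma qnum_Suc: "qnum (int (Suc a)) = qnum (int a) + q ^ a"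
proof -
  have "(1 - q) * qnum (int (Suc a)) = (1 - q) * (qnum (int a) + q ^ a)"
    unfolding distrib_left one_minus_q_mult_qnum by (simp add: algebra_simps)
  then show ?thesis by simp
qed

lemma qnum_Suc': "qnum (int (Suc a)) = 1 + q * qnum (int a)"
  using one_minus_q_mult_qnum [of a] unfolding qnum_Suc by (simp add: algebra_simps)

lemma q_powi_mult_qnum_diff: "q powi b * qnum (a - b) = qnum a - qnum b"
  by (simp add: qnum_def power_int_diff right_diff_distrib flip: diff_divide_distrib)

lemma qnum_diff_eq: "qnum (int a) - qnum (int b) = q ^ b * qnum (int a) - q ^ a * qnum (int b)"
proof -
  have "(1 - q ^ b) * qnum (int a) = (1 - q ^ a) * qnum (int b)"
    by (simp only: mult_ac flip: one_minus_q_mult_qnum)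
  then show ?thesis by (simp add: algebra_simps)
qed

lemma qfactorial_Suc: "qfactorial (Suc a) = qnum (int (Suc a)) * qfactorial a"
  by (simp add: qfactorial_def qfalling_def prod.lessThan_Suc_shift del: prod.lessThan_Suc)

lemma qfactorial_nonzero [simp]: "qfactorial a \<noteq> 0"
proof (induction a)
  case 0
  show ?case by (simp add: qfactorial_def qfalling_def)
next
  case (Suc a)
  then show ?case using qnum_nonzero [of "Suc a"] by (simp add: qfactorial_Suc del: of_nat_Suc)
qed

section \<open>The coefficients of \<open>(x; q)\<^sub>i\<close>\<close>

lemma qpoch_poly_Suc: "qpoch_poly (Suc i) = qpoch_poly i - pCons 0 (smult (q ^ i) (qpoch_poly i))"
  by (simp add: qpoch_poly_def algebra_simps)

lemma coeff_qpoch_0: "coeff (qpoch_poly 0) k = (if k = 0 then 1 else 0)"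
  by (simp add: qpoch_poly_def)

lemma coeff_qpoch_Suc_0: "coeff (qpoch_poly (Suc i)) 0 = coeff (qpoch_poly i) 0"
  by (simp add: qpoch_poly_Suc)

lemma coeff_qpoch_Suc_Suc:
  "coeff (qpoch_poly (Suc i)) (Suc k) = coeff (qpoch_poly i) (Suc k) - q ^ i * coeff (qpoch_poly i) k"
  by (simp add: qpoch_poly_Suc)

lemma coeff_qpoch_above: "i < k \<Longrightarrow> coeff (qpoch_poly i) k = 0"
proof (induction i arbitrary: k)
  case 0
  then show ?case by (simp add: coeff_qpoch_0)
next
  case (Suc i)
  then show ?case by (cases k) (auto simp: coeff_qpoch_Suc_Suc)
qed

lemma coeff_qpoch_diag: "coeff (qpoch_poly i) i \<noteq> 0"
  by (induction i) (auto simp: coeff_qpoch_0 coeff_qpoch_Suc_Suc coeff_qpoch_above)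

text \<open>
  The coefficients of \<open>(x; q)\<^sub>i\<close> are \<open>q\<close>-binomial coefficients up to signs and powers of \<open>q\<close>; only
  the ratios of neighbouring ones are needed.
\<close>

lemma coeff_qpoch_ratio:
  "qnum (int (Suc k)) * coeff (qpoch_poly i) (Suc k)
    = (qnum (int k) - qnum (int i)) * coeff (qpoch_poly i) k"
proof (induction i arbitrary: k)
  case 0
  then show ?case by (simp add: coeff_qpoch_0)
next
  case (Suc i)
  have step: "qnum (int (Suc k)) * coeff (qpoch_poly (Suc i)) (Suc k)
      = (qnum (int k) - qnum (int i) - q ^ i * qnum (int (Suc k))) * coeff (qpoch_poly i) k"
    using Suc.IH [of k] by (simp add: coeff_qpoch_Suc_Suc algebra_simps del: of_nat_Suc)
  show ?case
  proof (cases k)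
    case 0
    then show ?thesis
      using step by (simp add: coeff_qpoch_Suc_0 qnum_Suc del: of_nat_Suc)
  next
    case (Suc l)
    define u where "u = coeff (qpoch_poly i) k"
    define v where "v = coeff (qpoch_poly i) l"
    have IH: "qnum (int k) * u = (qnum (int l) - qnum (int i)) * v"
      using Suc.IH [of l] Suc by (simp add: u_def v_def del: of_nat_Suc)
    have "qnum (int (Suc k)) = 1 + q * qnum (int k)" "qnum (int k) = 1 + q * qnum (int l)"
      "qnum (int (Suc i)) = 1 + q * qnum (int i)" "qnum (int (Suc i)) = qnum (int i) + q ^ i"
      using qnum_Suc' [of k] qnum_Suc' [of l] qnum_Suc' [of i] qnum_Suc [of i] Suc by auto
    then have coeffs: "1 - qnum (int (Suc k)) = - q * qnum (int k)"
      "qnum (int k) - qnum (int (Suc i)) = q * (qnum (int l) - qnum (int i))"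
      "qnum (int (Suc i)) - qnum (int i) - q ^ i = 0"
      by (simp_all add: algebra_simps)
    have "(qnum (int k) - qnum (int i) - q ^ i * qnum (int (Suc k))) * u
          - (qnum (int k) - qnum (int (Suc i))) * (u - q ^ i * v)
        = (qnum (int (Suc i)) - qnum (int i) - q ^ i) * u
          + q ^ i * ((1 - qnum (int (Suc k))) * u + (qnum (int k) - qnum (int (Suc i))) * v)"
      by (simp add: algebra_simps del: of_nat_Suc)
    also have "\<dots> = 0"
      unfolding coeffs using IH by (simp add: mult.assoc)
    finally show ?thesis
      using step by (simp add: Suc coeff_qpoch_Suc_Suc u_def v_def del: of_nat_Suc)
  qed
qed

lemma coeff_qpoch_lower:
  "qnum (int (Suc i)) * q ^ k * coeff (qpoch_poly i) k
    = (qnum (int (Suc i)) - qnum (int k)) * coeff (qpoch_poly (Suc i)) k"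
proof (cases k)
  case 0
  then show ?thesis by (simp add: coeff_qpoch_Suc_0)
next
  case (Suc l)
  define u where "u = coeff (qpoch_poly i) k"
  define v where "v = coeff (qpoch_poly i) l"
  have ratio: "qnum (int k) * u = (qnum (int l) - qnum (int i)) * v"
    using coeff_qpoch_ratio [of l i] Suc by (simp add: u_def v_def del: of_nat_Suc)
  have diff: "qnum (int (Suc i)) - qnum (int k) = q * (qnum (int i) - qnum (int l))"
    using qnum_Suc' [of i] qnum_Suc' [of l] Suc by (simp add: algebra_simps)
  have "(qnum (int (Suc i)) - qnum (int k)) * (u - q ^ i * v)
      = (qnum (int (Suc i)) - qnum (int k)) * u - q ^ i * ((qnum (int (Suc i)) - qnum (int k)) * v)"
    by (simp add: algebra_simps del: of_nat_Suc)
  also have "(qnum (int (Suc i)) - qnum (int k)) * v = - q * (qnum (int k) * u)"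
    unfolding diff ratio by (simp add: algebra_simps)
  also have "(qnum (int (Suc i)) - qnum (int k)) * u
      = (q ^ k * qnum (int (Suc i)) - q ^ Suc i * qnum (int k)) * u"
    by (simp only: qnum_diff_eq [of "Suc i" k])
  also have "\<dots> - q ^ i * (- q * (qnum (int k) * u)) = qnum (int (Suc i)) * q ^ k * u"
    by (simp add: algebra_simps del: of_nat_Suc)
  finally show ?thesis
    by (simp add: Suc coeff_qpoch_Suc_Suc u_def v_def del: of_nat_Suc)
qed

text \<open>The \<open>q\<close>-derivative of \<open>(x; q)\<^sub>i\<^sub>+\<^sub>1\<close> is \<open>- [i + 1] (q x; q)\<^sub>i\<close>.\<close>

lemma coeff_qpoch_derivative:
  "qnum (int (Suc k)) * coeff (qpoch_poly (Suc i)) (Suc k)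
    = - qnum (int (Suc i)) * q ^ k * coeff (qpoch_poly i) k"
  using coeff_qpoch_ratio [of k "Suc i"] coeff_qpoch_lower [of i k]
  by (simp add: algebra_simps del: of_nat_Suc)

text \<open>\<open>(x / q; q)\<^sub>i\<^sub>+\<^sub>1\<close> in the basis: \<open>q\<^bsup>-i-1\<^esup> (x; q)\<^sub>i\<^sub>+\<^sub>1 + (1 - q\<^bsup>-i-1\<^esup>) (x; q)\<^sub>i\<close>.\<close>

lemma coeff_qpoch_rescale:
  "q powi (- int k) * coeff (qpoch_poly (Suc i)) k
    = q powi (- int (Suc i)) * coeff (qpoch_poly (Suc i)) k
      + (1 - q powi (- int (Suc i))) * coeff (qpoch_poly i) k"
proof -
  have "(1 - q ^ Suc i) * q ^ k * coeff (qpoch_poly i) k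
      = (q ^ k - q ^ Suc i) * coeff (qpoch_poly (Suc i)) k"
  proof -
    have "(1 - q ^ Suc i) * q ^ k * coeff (qpoch_poly i) k
        = (1 - q) * (qnum (int (Suc i)) * q ^ k * coeff (qpoch_poly i) k)"
      by (simp only: mult.assoc flip: one_minus_q_mult_qnum)
    also have "\<dots> = ((1 - q) * qnum (int (Suc i)) - (1 - q) * qnum (int k)) * coeff (qpoch_poly (Suc i)) k"
      unfolding coeff_qpoch_lower by (simp add: algebra_simps del: of_nat_Suc power_Suc)
    finally show ?thesis
      by (simp only: one_minus_q_mult_qnum) simp
  qed
  then show ?thesis
    by (simp add: power_int_minus field_simps del: of_nat_Suc power_Suc)
qed

text \<open>Linear independence of the \<open>(x; q)\<^sub>i\<close>, in terms of the coefficients up to the top degree.\<close>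

lemma qpoch_combination_eq_0:
  assumes "\<forall>k\<le>N. (\<Sum>i\<le>N. a i * coeff (qpoch_poly i) k) = 0"
  shows "\<forall>i\<le>N. a i = 0"
  using assms
proof (induction N)
  case 0
  then show ?case by (simp add: coeff_qpoch_0)
next
  case (Suc N)
  have "(\<Sum>i\<le>N. a i * coeff (qpoch_poly i) (Suc N)) = 0"
    by (intro sum.neutral) (auto simp: coeff_qpoch_above)
  with Suc.prems have top: "a (Suc N) = 0"
    using coeff_qpoch_diag [of "Suc N"] by fastforce
  with Suc.prems have "\<forall>k\<le>N. (\<Sum>i\<le>N. a i * coeff (qpoch_poly i) k) = 0"
    by simp
  with Suc.IH top show ?case by (auto simp: le_Suc_eq)
qed

lemma qpoch_combination_eq_iff:
  assumes "C \<noteq> 0" and w: "\<And>i. i \<le> N \<Longrightarrow> w i \<noteq> 0"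
  shows "(\<forall>k\<le>N. C * (\<Sum>i\<le>N. a i * w i * coeff (qpoch_poly i) k)
                = C * (\<Sum>i\<le>N. b i * w i * coeff (qpoch_poly i) k))
    \<longleftrightarrow> (\<forall>i\<le>N. a i = b i)"
proof
  assume "\<forall>k\<le>N. C * (\<Sum>i\<le>N. a i * w i * coeff (qpoch_poly i) k)
                = C * (\<Sum>i\<le>N. b i * w i * coeff (qpoch_poly i) k)"
  then have "\<forall>k\<le>N. (\<Sum>i\<le>N. ((a i - b i) * w i) * coeff (qpoch_poly i) k) = 0"
    using \<open>C \<noteq> 0\<close> by (simp add: algebra_simps sum_subtractf)
  from qpoch_combination_eq_0 [OF this] w show "\<forall>i\<le>N. a i = b i" by auto
qed simp

section \<open>Sizes of boards with deleted rows and columns\<close>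

lemma cells_eq_Sigma: "cells lam = Sigma {1..length lam} (\<lambda>i. {1..part lam i})"
  by (auto simp: cells_def)

lemma card_cells: "card (cells lam) = sum_list lam"
proof -
  have "card (cells lam) = (\<Sum>i=1..length lam. part lam i)"
    by (simp add: cells_eq_Sigma)
  also have "\<dots> = (\<Sum>i=Suc 0..<Suc (length lam). part lam i)"
    by (rule sum.cong) auto
  also have "\<dots> = (\<Sum>i=0..<length lam. lam ! i)"
    unfolding sum.shift_bounds_Suc_ivl by (rule sum.cong) (auto simp: part_def)
  finally show ?thesis by (simp add: sum_list_sum_nth)
qed

lemma conj_part_eq_length_filter:
  assumes "1 \<le> j"
  shows "conj_part lam j = length (filter (\<lambda>p. j \<le> p) lam)"
proof -
  have "{i. (i, j) \<in> cells lam} = Suc ` {i. i < length lam \<and> j \<le> lam ! i}"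
  proof (intro set_eqI iffI)
    fix i
    assume "i \<in> {i. (i, j) \<in> cells lam}"
    then show "i \<in> Suc ` {i. i < length lam \<and> j \<le> lam ! i}"
      by (cases i) (auto simp: cells_def part_def)
  qed (use assms in \<open>auto simp: cells_def part_def\<close>)
  then show ?thesis
    by (simp add: conj_part_def length_filter_conv_card card_image)
qed

lemma card_cells_remove_col:
  assumes "1 \<le> j"
  shows "card (cells (remove_col j lam)) + conj_part lam j = card (cells lam)"
proof -
  have "sum_list (remove_col j lam) + length (filter (\<lambda>p. j \<le> p) lam) = sum_list lam"
    using assms by (induction lam) (auto simp: remove_col_def)
  then show ?thesis using assms by (simp add: card_cells conj_part_eq_length_filter)
qed

lemma list_split_part:
  assumes "1 \<le> i" "i \<le> length lam"
  shows "lam = take (i - 1) lam @ part lam i # drop i lam"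
  using id_take_nth_drop [of "i - 1" lam] assms by (simp add: part_def)

lemma length_remove_row: "1 \<le> i \<Longrightarrow> i \<le> length lam \<Longrightarrow> length (remove_row i lam) = length lam - 1"
  by (simp add: remove_row_def)

lemma card_cells_remove_row:
  assumes "1 \<le> i" "i \<le> length lam"
  shows "card (cells (remove_row i lam)) + part lam i = card (cells lam)"
  unfolding card_cells by (subst (3) list_split_part [OF assms]) (simp add: remove_row_def)

lemma card_cells_remove_cell:
  assumes "(i, j) \<in> cells lam"
  shows "card (cells (remove_cell i j lam)) + part lam i + conj_part lam j = card (cells lam) + 1"
proof -
  have ij: "1 \<le> i" "i \<le> length lam" "1 \<le> j" "j \<le> part lam i"
    using assms by (auto simp: cells_def)
  have "conj_part lam j = conj_part (remove_row i lam) j + 1"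
    unfolding conj_part_eq_length_filter [OF ij(3)]
    by (subst list_split_part [OF ij(1,2)]) (simp add: remove_row_def ij(4))
  then show ?thesis
    using card_cells_remove_row [OF ij(1,2)] card_cells_remove_col [OF ij(3), of "remove_row i lam"]
    by (simp add: remove_cell_def)
qed

lemma conj_part_eq_0:
  assumes "\<forall>p\<in>set lam. p \<le> m" "m < j"
  shows "conj_part lam j = 0"
  using assms by (subst conj_part_eq_length_filter) (auto simp: filter_empty_conv)

text \<open>The rooks of a placement lie in distinct rows.\<close>

lemma qrook_eq_0:
  assumes "length lam < k"
  shows "qrook k lam = 0"
proof -
  have False if "p \<in> rook_placements k lam" for p
  proof -
    have p: "p \<subseteq> cells lam" "card p = k" "inj_on fst p"
      using that by (auto simp: rook_placements_def)
    have "card p \<le> card {1..length lam}"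
      by (rule card_inj_on_le [OF p(3)]) (use p(1) in \<open>auto simp: cells_def\<close>)
    with p(2) assms show False by simp
  qed
  then have "rook_placements k lam = {}" by blast
  then show ?thesis by (simp add: qrook_def)
qed

section \<open>Hit numbers in terms of rook numbers\<close>

text \<open>
  The weight of \<open>(x; q)\<^sub>i\<close> in the hit polynomial of a board with \<open>m\<close> columns: it multiplies the
  \<open>i\<close>-th rook number and depends on neither the partition nor the number of rows.
\<close>

definition hit_weight :: "nat \<Rightarrow> nat \<Rightarrow> ratfun"
  where "hit_weight m i = qfactorial (m - i) * (-1) ^ i * q powi (int (m * i) - int (i choose 2))"

lemma hit_weight_nonzero [simp]: "hit_weight m i \<noteq> 0"
  by (simp add: hit_weight_def)

lemma hit_weight_Suc_Suc: "hit_weight (Suc m) (Suc i) = - (q ^ Suc m) * hit_weight m i"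
proof -
  have "int (Suc m * Suc i) - int (Suc i choose 2) = int (Suc m) + (int (m * i) - int (i choose 2))"
    by (simp add: numeral_2_eq_2 algebra_simps)
  then have "q powi (int (Suc m * Suc i) - int (Suc i choose 2))
      = q ^ Suc m * q powi (int (m * i) - int (i choose 2))"
    by (simp only: power_int_add power_int_of_nat q_nonzero simp_thms)
  then show ?thesis
    unfolding hit_weight_def by simp
qed

lemma hit_weight_Suc:
  assumes "i \<le> m"
  shows "hit_weight (Suc m) i = qnum (int (Suc m) - int i) * q ^ i * hit_weight m i"
proof -
  have "int (Suc m * i) - int (i choose 2) = int i + (int (m * i) - int (i choose 2))"
    by simp
  then have "q powi (int (Suc m * i) - int (i choose 2))
      = q ^ i * q powi (int (m * i) - int (i choose 2))"
    by (simp only: power_int_add power_int_of_nat q_nonzero simp_thms)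
  moreover have "qfactorial (Suc m - i) = qnum (int (Suc m) - int i) * qfactorial (m - i)"
    using assms by (simp add: Suc_diff_le qfactorial_Suc of_nat_diff algebra_simps)
  ultimately show ?thesis
    unfolding hit_weight_def by simp
qed

lemma qhit_eq:
  "qhit k m n lam = q powi (- int (card (cells lam))) / qfactorial (m - n)
    * (\<Sum>i\<le>n. qrook i lam * hit_weight m i * coeff (qpoch_poly i) k)"
  by (simp add: qhit_def qhit_poly_def hit_weight_def coeff_sum mult.assoc)

text \<open>
  A combination of hit numbers of smaller boards, once the powers of \<open>q\<close> are collected so that the
  boards enter only through factors \<open>c b\<close> and through their rook numbers.
\<close>

lemma sum_qhit_eq:
  assumes "\<And>b. b \<in> B \<Longrightarrow> f b * q powi (- int (card (cells (L b)))) = K * c b"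
  shows "(\<Sum>b\<in>B. f b * qhit k m n (L b))
    = K / qfactorial (m - n)
      * (\<Sum>i\<le>n. (\<Sum>b\<in>B. c b * qrook i (L b)) * hit_weight m i * coeff (qpoch_poly i) k)"
proof -
  have "(\<Sum>b\<in>B. f b * qhit k m n (L b))
      = (\<Sum>b\<in>B. (f b * q powi (- int (card (cells (L b))))) / qfactorial (m - n)
          * (\<Sum>i\<le>n. qrook i (L b) * hit_weight m i * coeff (qpoch_poly i) k))"
    by (simp add: qhit_eq mult.assoc)
  also have "\<dots> = (\<Sum>b\<in>B. (K * c b) / qfactorial (m - n)
          * (\<Sum>i\<le>n. qrook i (L b) * hit_weight m i * coeff (qpoch_poly i) k))"
    using assms by (intro sum.cong) auto
  also have "\<dots> = (\<Sum>b\<in>B. \<Sum>i\<le>n. K / qfactorial (m - n)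
          * (c b * qrook i (L b) * hit_weight m i * coeff (qpoch_poly i) k))"
    by (simp add: sum_distrib_left mult_ac)
  also have "\<dots> = (\<Sum>i\<le>n. \<Sum>b\<in>B. K / qfactorial (m - n)
          * (c b * qrook i (L b) * hit_weight m i * coeff (qpoch_poly i) k))"
    by (rule sum.swap)
  finally show ?thesis
    by (simp add: sum_distrib_left sum_distrib_right)
qed

section \<open>The three equivalences\<close>

text \<open>Deletion of columns; the factor \<open>q\<^bsup>n-k\<^esup>\<close> rescales the variable of the hit polynomial.\<close>

lemma hit_iff_rook_remove_col:
  assumes len: "length lam = n" and mn: "n < m"
  shows "(\<forall>k\<le>n. (\<Sum>i=1..m. q powi (int m + int n - int i - int (conj_part lam i))
                            * qhit k (m - 1) n (remove_col i lam))
                = qnum (int m - int n) * qhit k m n lam * q powi (int n - int k))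
        \<longleftrightarrow>
        (\<forall>k\<le>n. (\<Sum>j=1..m. q powi (int m - int j) * qrook k (remove_col j lam))
                = qrook k lam * qnum (int m - int k)
                  - qrook (k + 1) lam * (q powi int m - q powi (int m - int k - 1)))"
proof -
  obtain l where m: "m = Suc l" and nl: "n \<le> l"
    using mn by (cases m) auto
  let ?e = "\<lambda>i k. coeff (qpoch_poly i) k"
  define K where "K = q powi (int n - int (card (cells lam)))"
  define C where "C = K / qfactorial (l - n)"
  define b where "b = (\<lambda>i. qrook i lam * qnum (int m - int i)
                  - qrook (i + 1) lam * (q powi int m - q powi (int m - int i - 1)))"
  have lhs: "(\<Sum>i=1..m. q powi (int m + int n - int i - int (conj_part lam i))
                            * qhit k (m - 1) n (remove_col i lam))
      = C * (\<Sum>i\<le>n. (\<Sum>j=1..m. q powi (int m - int j) * qrook i (remove_col j lam))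
                     * hit_weight l i * ?e i k)" for k
  proof -
    have "q powi (int m + int n - int j - int (conj_part lam j))
        * q powi (- int (card (cells (remove_col j lam)))) = K * q powi (int m - int j)"
      if "j \<in> {1..m}" for j
    proof -
      have "int (card (cells lam)) = int (card (cells (remove_col j lam))) + int (conj_part lam j)"
        using card_cells_remove_col [of j lam] that by simp
      then show ?thesis
        by (simp add: K_def flip: power_int_add) (simp add: algebra_simps)
    qed
    then have "(\<Sum>i=1..m. q powi (int m + int n - int i - int (conj_part lam i))
                            * qhit k l n (remove_col i lam))
      = K / qfactorial (l - n)
        * (\<Sum>i\<le>n. (\<Sum>j=1..m. q powi (int m - int j) * qrook i (remove_col j lam))
                     * hit_weight l i * ?e i k)"
      by (rule sum_qhit_eq)
    then show ?thesis by (simp add: C_def m)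
  qed
  have rhs: "qnum (int m - int n) * qhit k m n lam * q powi (int n - int k)
      = C * (\<Sum>i\<le>n. b i * hit_weight l i * ?e i k)" for k
  proof -
    define g where "g = (\<lambda>i. qrook i lam * hit_weight m i)"
    have fact: "qfactorial (m - n) = qnum (int m - int n) * qfactorial (l - n)"
      and nz: "qnum (int m - int n) \<noteq> 0"
      using nl qnum_nonzero [of "m - n"]
      by (simp_all add: m Suc_diff_le qfactorial_Suc of_nat_diff algebra_simps)
    have "qnum (int m - int n) * qhit k m n lam * q powi (int n - int k)
        = C * (q powi (- int k) * (\<Sum>i\<le>n. g i * ?e i k))"
      using nz by (simp add: qhit_eq fact C_def K_def g_def power_int_diff power_int_minus divide_simps)
    also have "q powi (- int k) * (\<Sum>i\<le>n. g i * ?e i k)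
        = (\<Sum>i\<le>n. g i * (q powi (- int k) * ?e i k))"
      by (simp add: sum_distrib_left mult_ac)
    \<comment> \<open>For \<open>i = 0\<close> the second summand is zero, whatever \<open>?e (i - 1)\<close> stands for.\<close>
    also have "\<dots> = (\<Sum>i\<le>n. g i * q powi (- int i) * ?e i k
                        + g i * (1 - q powi (- int i)) * ?e (i - 1) k)"
    proof (rule sum.cong)
      fix i
      show "g i * (q powi (- int k) * ?e i k)
          = g i * q powi (- int i) * ?e i k + g i * (1 - q powi (- int i)) * ?e (i - 1) k"
      proof (cases i)
        case 0
        then show ?thesis by (simp add: coeff_qpoch_0)
      next
        case (Suc i')
        then show ?thesis
          using arg_cong [OF coeff_qpoch_rescale [of k i'], of "\<lambda>x. g i * x"]
          by (simp add: algebra_simps del: of_nat_Suc)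
      qed
    qed simp
    also have "\<dots> = (\<Sum>i\<le>n. g i * q powi (- int i) * ?e i k)
        + (\<Sum>i\<le>n. g i * (1 - q powi (- int i)) * ?e (i - 1) k)"
      by (rule sum.distrib)
    \<comment> \<open>The index is shifted at no cost: the new top term contains the rook number of \<open>n + 1\<close> rooks
      and vanishes.\<close>
    also have "(\<Sum>i\<le>n. g i * (1 - q powi (- int i)) * ?e (i - 1) k)
        = (\<Sum>i\<le>n. g (Suc i) * (1 - q powi (- int (Suc i))) * ?e i k)"
    proof -
      have "(\<Sum>i\<le>n. g i * (1 - q powi (- int i)) * ?e (i - 1) k)
          = (\<Sum>i\<le>Suc n. g i * (1 - q powi (- int i)) * ?e (i - 1) k)"
        by (simp add: g_def qrook_eq_0 len)
      also have "\<dots> = (\<Sum>i\<le>n. g (Suc i) * (1 - q powi (- int (Suc i))) * ?e i k)"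
        by (subst sum.atMost_Suc_shift) simp
      finally show ?thesis .
    qed
    also have "(\<Sum>i\<le>n. g i * q powi (- int i) * ?e i k)
          + (\<Sum>i\<le>n. g (Suc i) * (1 - q powi (- int (Suc i))) * ?e i k)
        = (\<Sum>i\<le>n. b i * hit_weight l i * ?e i k)"
      unfolding sum.distrib [symmetric]
    proof (rule sum.cong)
      fix i
      assume "i \<in> {..n}"
      then have "i \<le> l" using nl by simp
      then have "g i * q powi (- int i) = qrook i lam * qnum (int m - int i) * hit_weight l i"
        by (simp add: g_def m hit_weight_Suc power_int_minus del: of_nat_Suc)
      moreover have "g (Suc i) * (1 - q powi (- int (Suc i)))
          = - qrook (i + 1) lam * (q powi int m - q powi (int m - int i - 1)) * hit_weight l i"
      proof -
        have "q powi (int m - int i - 1) = q ^ m * q powi (- int (Suc i))"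
          using power_int_add [of q "int m" "- int (Suc i)"] by (simp add: algebra_simps)
        then show ?thesis
          by (simp add: g_def m hit_weight_Suc_Suc algebra_simps del: of_nat_Suc power_Suc)
      qed
      ultimately show "g i * q powi (- int i) * ?e i k
            + g (Suc i) * (1 - q powi (- int (Suc i))) * ?e i k
          = b i * hit_weight l i * ?e i k"
        by (simp only: b_def) (simp add: algebra_simps)
    qed simp
    finally show ?thesis .
  qed
  have "C \<noteq> 0" by (simp add: C_def K_def)
  then show ?thesis
    unfolding lhs rhs by (subst qpoch_combination_eq_iff) (auto simp: b_def)
qed

text \<open>
  Deletion of rows. The substitution of \<open>m + n + 1 - i\<close> for the summation index runs through the
  rows, and the indices \<open>i > m\<close> are those of empty columns. The basis consists of eigenvectors of
  the operator on the right-hand side, with eigenvalues \<open>[n] - [i]\<close>.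
\<close>

lemma hit_iff_rook_remove_row:
  assumes nm: "n \<le> m" and len: "length lam = n" and parts: "\<forall>p\<in>set lam. p \<le> m" and n1: "1 \<le> n"
  shows "(\<forall>k\<le>n - 1. qnum (int m - int n + 1)
                    * (\<Sum>i=m+1..m+n. q powi (int m + int n - int i - int (conj_part lam i))
                                     * qhit k m (n - 1) (remove_row (m + n + 1 - i) lam))
                = qhit k m n lam * q powi int k * qnum (int n - int k)
                  + qhit (k + 1) m n lam * qnum (int k + 1))
        \<longleftrightarrow>
        (\<forall>k\<le>n. (\<Sum>i=1..n. q powi (int i - 1 + int (part lam i)) * qrook k (remove_row i lam))
                = (qnum (int n) - qnum (int k)) * qrook k lam)"
proof -
  obtain n' where n: "n = Suc n'"
    using n1 by (cases n) auto
  let ?e = "\<lambda>i k. coeff (qpoch_poly i) k"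
  let ?S = "\<lambda>k. \<Sum>i=1..n. q powi (int i - 1 + int (part lam i)) * qrook k (remove_row i lam)"
  define K where "K = q powi (- int (card (cells lam)))"
  define C where "C = K / qfactorial (m - n)"
  have lhs: "qnum (int m - int n + 1)
        * (\<Sum>i=m+1..m+n. q powi (int m + int n - int i - int (conj_part lam i))
                                     * qhit k m (n - 1) (remove_row (m + n + 1 - i) lam))
      = C * (\<Sum>i\<le>n'. ?S i * hit_weight m i * ?e i k)" for k
  proof -
    have "(\<Sum>i=m+1..m+n. q powi (int m + int n - int i - int (conj_part lam i))
                                     * qhit k m (n - 1) (remove_row (m + n + 1 - i) lam))
        = (\<Sum>i=1..n. q powi (int i - 1) * qhit k m n' (remove_row i lam))"
    proof (rule sum.reindex_bij_witness [where i = "\<lambda>i. m + n + 1 - i" and j = "\<lambda>i. m + n + 1 - i"])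
      fix i
      assume "i \<in> {m+1..m+n}"
      then show "q powi (int (m + n + 1 - i) - 1) * qhit k m n' (remove_row (m + n + 1 - i) lam)
          = q powi (int m + int n - int i - int (conj_part lam i))
              * qhit k m (n - 1) (remove_row (m + n + 1 - i) lam)"
        using conj_part_eq_0 [OF parts, of i] by (simp add: n of_nat_diff algebra_simps)
    qed auto
    also have "\<dots> = K / qfactorial (m - n') * (\<Sum>i\<le>n'. ?S i * hit_weight m i * ?e i k)"
    proof (rule sum_qhit_eq)
      fix i
      assume "i \<in> {1..n}"
      then have "int (card (cells lam)) = int (card (cells (remove_row i lam))) + int (part lam i)"
        using card_cells_remove_row [of i lam] len by simp
      then show "q powi (int i - 1) * q powi (- int (card (cells (remove_row i lam))))
          = K * q powi (int i - 1 + int (part lam i))"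
        by (simp add: K_def flip: power_int_add)
    qed
    finally have eq: "(\<Sum>i=m+1..m+n. q powi (int m + int n - int i - int (conj_part lam i))
                                     * qhit k m (n - 1) (remove_row (m + n + 1 - i) lam))
        = K / qfactorial (m - n') * (\<Sum>i\<le>n'. ?S i * hit_weight m i * ?e i k)" .
    have "m - n' = Suc (m - n)" "int (Suc (m - n)) = int m - int n + 1"
      using nm by (simp_all add: n of_nat_diff)
    then have "qfactorial (m - n') = qnum (int m - int n + 1) * qfactorial (m - n)"
      and "qnum (int m - int n + 1) \<noteq> 0"
      using qnum_nonzero [of "Suc (m - n)"] by (simp_all only: qfactorial_Suc) simp
    then show ?thesis by (simp only: eq C_def) simp
  qed
  have rhs: "qhit k m n lam * q powi int k * qnum (int n - int k)
        + qhit (k + 1) m n lam * qnum (int k + 1)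
      = C * (\<Sum>i\<le>n'. (qnum (int n) - qnum (int i)) * qrook i lam * hit_weight m i * ?e i k)" for k
  proof -
    define g where "g = (\<lambda>i. qrook i lam * hit_weight m i)"
    have "qhit k m n lam * q powi int k * qnum (int n - int k)
        + qhit (k + 1) m n lam * qnum (int k + 1)
        = qhit k m n lam * (q powi int k * qnum (int n - int k))
        + qhit (Suc k) m n lam * qnum (int (Suc k))"
      by (simp add: add.commute mult.assoc)
    also have "\<dots> = C * ((\<Sum>i\<le>n. g i * ?e i k) * (qnum (int n) - qnum (int k))
        + (\<Sum>i\<le>n. g i * ?e i (Suc k)) * qnum (int (Suc k)))"
      unfolding q_powi_mult_qnum_diff
      by (simp add: qhit_eq C_def K_def g_def distrib_left mult_ac del: of_nat_Suc)
    also have "(\<Sum>i\<le>n. g i * ?e i k) * (qnum (int n) - qnum (int k))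
        + (\<Sum>i\<le>n. g i * ?e i (Suc k)) * qnum (int (Suc k))
        = (\<Sum>i\<le>n. g i * (?e i k * (qnum (int n) - qnum (int k)) + qnum (int (Suc k)) * ?e i (Suc k)))"
      unfolding sum_distrib_right sum.distrib [symmetric]
      by (rule sum.cong) (simp_all add: distrib_left mult_ac del: of_nat_Suc)
    also have "\<dots> = (\<Sum>i\<le>n. (qnum (int n) - qnum (int i)) * qrook i lam * hit_weight m i * ?e i k)"
      unfolding coeff_qpoch_ratio by (simp add: g_def algebra_simps)
    finally show ?thesis by (simp add: n del: of_nat_Suc)
  qed
  \<comment> \<open>The rook identity for \<open>n\<close> rooks has no counterpart among the hit identities: both sides vanish.\<close>
  have top: "?S n = (qnum (int n) - qnum (int n)) * qrook n lam"
    using len by (simp add: qrook_eq_0 length_remove_row n)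
  have "C \<noteq> 0" by (simp add: C_def K_def)
  then have "(\<forall>k\<le>n'. C * (\<Sum>i\<le>n'. ?S i * hit_weight m i * ?e i k)
      = C * (\<Sum>i\<le>n'. (qnum (int n) - qnum (int i)) * qrook i lam * hit_weight m i * ?e i k))
    \<longleftrightarrow> (\<forall>i\<le>n'. ?S i = (qnum (int n) - qnum (int i)) * qrook i lam)"
    by (rule qpoch_combination_eq_iff) simp
  also have "\<dots> \<longleftrightarrow> (\<forall>i\<le>n. ?S i = (qnum (int n) - qnum (int i)) * qrook i lam)"
  proof -
    have "(\<forall>i\<le>n. P i) \<longleftrightarrow> (\<forall>i\<le>n'. P i) \<and> P n" for P
      by (auto simp: n le_Suc_eq)
    from this [of "\<lambda>i. ?S i = (qnum (int n) - qnum (int i)) * qrook i lam"] top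
    show ?thesis by blast
  qed
  finally show ?thesis
    unfolding lhs rhs by (simp only: n diff_Suc_1)
qed

text \<open>
  Deletion of the row and the column of a cell; the right-hand side is the \<open>q\<close>-derivative of the
  hit polynomial.
\<close>

lemma hit_iff_rook_remove_cell:
  assumes nm: "n \<le> m" and n1: "1 \<le> n"
  shows "(\<forall>k\<le>n - 1. q powi int k
                    * (\<Sum>(i, j)\<in>cells lam. q powi (int i + (int m - int j - int (conj_part lam j)))
                                     * qhit k (m - 1) (n - 1) (remove_cell i j lam))
                = qnum (int k + 1) * qhit (k + 1) m n lam)
        \<longleftrightarrow>
        (\<forall>k\<le>n - 1. (\<Sum>(i, j)\<in>cells lam. q powi (int i - int j + int (part lam i))
                                     * qrook k (remove_cell i j lam))
                = q * qnum (int k + 1) * qrook (k + 1) lam)"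
proof -
  obtain n' where n: "n = Suc n'"
    using n1 by (cases n) auto
  obtain l where m: "m = Suc l"
    using nm n by (cases m) auto
  let ?e = "\<lambda>i k. coeff (qpoch_poly i) k"
  let ?S = "\<lambda>k. \<Sum>(i, j)\<in>cells lam. q powi (int i - int j + int (part lam i))
                                     * qrook k (remove_cell i j lam)"
  let ?R = "\<lambda>k. q * qnum (int k + 1) * qrook (k + 1) lam"
  define K where "K = q powi (int l - int (card (cells lam)))"
  define C where "C = K / qfactorial (m - n)"
  have lhs: "(\<Sum>(i, j)\<in>cells lam. q powi (int i + (int m - int j - int (conj_part lam j)))
                                     * qhit k (m - 1) (n - 1) (remove_cell i j lam))
      = C * (\<Sum>t\<le>n'. ?S t * hit_weight l t * ?e t k)" for k
  proof -
    have "(\<Sum>b\<in>cells lam. q powi (int (fst b) + (int m - int (snd b) - int (conj_part lam (snd b))))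
              * qhit k l n' (remove_cell (fst b) (snd b) lam))
        = K / qfactorial (l - n')
          * (\<Sum>t\<le>n'. (\<Sum>b\<in>cells lam. q powi (int (fst b) - int (snd b) + int (part lam (fst b)))
                * qrook t (remove_cell (fst b) (snd b) lam)) * hit_weight l t * ?e t k)"
    proof (rule sum_qhit_eq)
      fix b
      assume "b \<in> cells lam"
      then have "int (card (cells lam)) = int (card (cells (remove_cell (fst b) (snd b) lam)))
          + int (part lam (fst b)) + int (conj_part lam (snd b)) - 1"
        using card_cells_remove_cell [of "fst b" "snd b" lam] by simp
      then show "q powi (int (fst b) + (int m - int (snd b) - int (conj_part lam (snd b))))
            * q powi (- int (card (cells (remove_cell (fst b) (snd b) lam))))
          = K * q powi (int (fst b) - int (snd b) + int (part lam (fst b)))"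
        by (simp add: K_def m flip: power_int_add) (simp add: algebra_simps)
    qed
    then show ?thesis by (simp add: C_def m n case_prod_beta)
  qed
  have rhs: "qnum (int k + 1) * qhit (k + 1) m n lam
      = q powi int k * (C * (\<Sum>t\<le>n'. ?R t * hit_weight l t * ?e t k))" for k
  proof -
    have "qhit (k + 1) m n lam = q powi (- int (card (cells lam))) / qfactorial (m - n)
        * (\<Sum>t\<le>n'. qrook (Suc t) lam * hit_weight m (Suc t) * ?e (Suc t) (Suc k))"
      unfolding qhit_eq n by (subst sum.atMost_Suc_shift) (simp add: coeff_qpoch_0)
    then have "qnum (int k + 1) * qhit (k + 1) m n lam
        = q powi (- int (card (cells lam))) / qfactorial (m - n)
        * (\<Sum>t\<le>n'. qrook (Suc t) lam * hit_weight m (Suc t)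
                     * (qnum (int (Suc k)) * ?e (Suc t) (Suc k)))"
      by (simp add: sum_distrib_left mult_ac add.commute)
    also have "\<dots> = q powi (- int (card (cells lam))) / qfactorial (m - n)
        * (\<Sum>t\<le>n'. q powi int k * q ^ l * (?R t * hit_weight l t * ?e t k))"
      unfolding coeff_qpoch_derivative m hit_weight_Suc_Suc
      by (simp add: algebra_simps)
    also have "\<dots> = q powi int k * (C * (\<Sum>t\<le>n'. ?R t * hit_weight l t * ?e t k))"
      by (simp add: C_def K_def power_int_diff power_int_minus divide_simps
          flip: sum_distrib_left)
    finally show ?thesis .
  qed
  have "C \<noteq> 0" by (simp add: C_def K_def)
  then have "(\<forall>k\<le>n'. C * (\<Sum>t\<le>n'. ?S t * hit_weight l t * ?e t k)
      = C * (\<Sum>t\<le>n'. ?R t * hit_weight l t * ?e t k)) \<longleftrightarrow> (\<forall>t\<le>n'. ?S t = ?R t)"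
    by (rule qpoch_combination_eq_iff) simp
  then show ?thesis
    unfolding lhs rhs by (simp add: n)
qed

theorem lemma3p4:
  fixes m n :: nat and lam :: "nat list"
  assumes "n \<le> m"
    and "partition_in n m lam"
  shows
    "(m > n \<longrightarrow>
       ((\<forall>k\<le>n. (\<Sum>i=1..m. q powi (int m + int n - int i - int (conj_part lam i))
                            * qhit k (m - 1) n (remove_col i lam))
                = qnum (int m - int n) * qhit k m n lam * q powi (int n - int k))
        \<longleftrightarrow>
        (\<forall>k\<le>n. (\<Sum>j=1..m. q powi (int m - int j) * qrook k (remove_col j lam))
                = qrook k lam * qnum (int m - int k)
                  - qrook (k + 1) lam * (q powi int m - q powi (int m - int k - 1)))))
     \<and>
     (n \<ge> 1 \<longrightarrow>
       ((\<forall>k\<le>n - 1. qnum (int m - int n + 1)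
                    * (\<Sum>i=m+1..m+n. q powi (int m + int n - int i - int (conj_part lam i))
                                     * qhit k m (n - 1) (remove_row (m + n + 1 - i) lam))
                = qhit k m n lam * q powi int k * qnum (int n - int k)
                  + qhit (k + 1) m n lam * qnum (int k + 1))
        \<longleftrightarrow>
        (\<forall>k\<le>n. (\<Sum>i=1..n. q powi (int i - 1 + int (part lam i)) * qrook k (remove_row i lam))
                = (qnum (int n) - qnum (int k)) * qrook k lam)))
     \<and>
     (n \<ge> 1 \<longrightarrow>
       ((\<forall>k\<le>n - 1. q powi int k
                    * (\<Sum>(i, j)\<in>cells lam. q powi (int i + (int m - int j - int (conj_part lam j)))
                                     * qhit k (m - 1) (n - 1) (remove_cell i j lam))
                = qnum (int k + 1) * qhit (k + 1) m n lam)
        \<longleftrightarrow>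
        (\<forall>k\<le>n - 1. (\<Sum>(i, j)\<in>cells lam. q powi (int i - int j + int (part lam i))
                                     * qrook k (remove_cell i j lam))
                = q * qnum (int k + 1) * qrook (k + 1) lam)))"
  using assms hit_iff_rook_remove_col [of lam n m] hit_iff_rook_remove_row [of n m lam]
    hit_iff_rook_remove_cell [of n m lam]
  unfolding partition_in_def by blast

end
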